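(* Let $k\geq 1$ be an integer. Given a finite set of intervals $I$, the greedy best-fit algorithm (described in the context) computes a $k$-heapable subset of $I$ of maximum cardinality.
   Context: Intervals are closed real intervals $[a,b]$ with $a<b$. The (strict) partial order on intervals is: $[a_1,b_1]$ is below $[a_2,b_2]$ if and only if $b_1\leq a_2$. The total order $\sqsubseteq$ on intervals is: $[a_1,b_1]\sqsubseteq[a_2,b_2]$ if $b_1<b_2$, or $b_1=b_2$ and $a_1<a_2$. A rooted tree is $k$-ary if every node has at most $k$ children. A set $J$ of intervals is $k$-heapable (a $k$-ary chain) if there exist a $k$-ary rooted tree $T$ and a bijection between $J$ and the vertices of $T$ such that whenever $v$ is a (proper) descendant of $u$ in $T$, $u$ is below $v$. Greedy best-fit algorithm. Sort the intervals of $I$ with respect to $\sqsubseteq$ as $I_1,\ldots,I_n$. The algorithm builds a single $k$-ary tree, initially empty, whose set of nodes is $J$ (initially $J=\emptyset$). Initially there is a single empty slot (the root position), compatible with every interval. Inserting an interval $[a,b]$ into a slot fills that slot and creates $k$ new empty slots (the child positions of $[a,b]$), each of value $b$. A slot of value $x$ is compatible with $[a,b]$ if $x\leq a$. For $i=1,\ldots,n$: if $I_i$ is compatible with some empty slot, add $I_i$ to $J$ and insert it into a compatible empty slot of highest value; otherwise discard $I_i$. The output is $J$. *)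

theory Defs
  imports Complex_Main "HOL-Library.Interval" "HOL-Library.Extended_Real"
begin

text \<open>
  The library type of closed intervals also contains the degenerate ones; they are excluded by
  \<open>proper_intervals\<close> below.
\<close>

definition proper_intervals :: "real interval set" where
  "proper_intervals = {x. lower x < upper x}"

definition below :: "real interval \<Rightarrow> real interval \<Rightarrow> bool" where
  "below x y \<longleftrightarrow> upper x \<le> lower y"

text \<open>The strict part of the total order by right endpoint, ties broken by left endpoint.\<close>

definition sq_less :: "real interval \<Rightarrow> real interval \<Rightarrow> bool" where
  "sq_less x y \<longleftrightarrow> upper x < upper y \<or> (upper x = upper y \<and> lower x < lower y)"


text \<open>
  A rooted tree is given by its vertices and its (parent, child) arcs. Every vertex is reachable
  from the root and every vertex except the root has exactly one parent, which excludes cycles.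
\<close>

definition rooted_tree :: "'v set \<Rightarrow> ('v \<times> 'v) set \<Rightarrow> 'v \<Rightarrow> bool" where
  "rooted_tree V E r \<longleftrightarrow>
     r \<in> V \<and> E \<subseteq> V \<times> V \<and>
     (\<forall>v\<in>V. (r, v) \<in> E\<^sup>*) \<and>
     (\<forall>u. (u, r) \<notin> E) \<and>
     (\<forall>v\<in>V - {r}. \<exists>!u. (u, v) \<in> E)"

text \<open>
  The empty tree is admitted, so that the empty set of intervals is heapable. Finiteness of the
  set of children is explicit because \<^const>\<open>card\<close> is 0 on infinite sets.
\<close>

definition kary_tree :: "nat \<Rightarrow> 'v set \<Rightarrow> ('v \<times> 'v) set \<Rightarrow> bool" where
  "kary_tree k V E \<longleftrightarrow>
     (V = {} \<and> E = {}) \<or>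
     ((\<exists>r. rooted_tree V E r) \<and>
      (\<forall>u\<in>V. finite {v. (u, v) \<in> E} \<and> card {v. (u, v) \<in> E} \<le> k))"

text \<open>
  The tree may take its vertices from the type of intervals without loss of generality: a tree in
  bijection with a set of intervals can be transported to that set. The pairs in \<open>E\<^sup>+\<close> are
  the (vertex, proper descendant) pairs.
\<close>

definition k_heapable :: "nat \<Rightarrow> real interval set \<Rightarrow> bool" where
  "k_heapable k J \<longleftrightarrow>
     (\<exists>(V :: real interval set) E f.
        kary_tree k V E \<and> bij_betw f V J \<and>
        (\<forall>(u, v)\<in>E\<^sup>+. below (f u) (f v)))"


text \<open>
  The state of the algorithm is the tree built so far, as a partial map from positions (slots) to
  the intervals inserted there: \<open>Child x i\<close> is the \<open>i\<close>-th child position of \<open>x\<close>, for \<open>i < k\<close>.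
\<close>

datatype slot = Root | Child "real interval" nat

type_synonym state = "slot \<Rightarrow> real interval option"

definition empty_slots :: "nat \<Rightarrow> state \<Rightarrow> slot set" where
  "empty_slots k T = ({Root} \<union> {Child x i | x i. x \<in> ran T \<and> i < k}) - dom T"

text \<open>The value \<open>-\<infinity>\<close> makes the root position compatible with every interval.\<close>

fun slot_value :: "slot \<Rightarrow> ereal" where
  "slot_value Root = -\<infinity>"
| "slot_value (Child x i) = ereal (upper x)"

definition compatible :: "slot \<Rightarrow> real interval \<Rightarrow> bool" where
  "compatible s x \<longleftrightarrow> slot_value s \<le> ereal (lower x)"

definition best_fit :: "nat \<Rightarrow> state \<Rightarrow> real interval \<Rightarrow> slot \<Rightarrow> bool" where
  "best_fit k T x s \<longleftrightarrow>
     s \<in> empty_slots k T \<and> compatible s x \<and>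
     (\<forall>s'\<in>empty_slots k T. compatible s' x \<longrightarrow> slot_value s' \<le> slot_value s)"

text \<open>
  Several empty slots may share the highest compatible value, hence a run is a relation between
  the initial and the final state: every way of breaking these ties is allowed.
\<close>

inductive greedy_run :: "nat \<Rightarrow> real interval list \<Rightarrow> state \<Rightarrow> state \<Rightarrow> bool" for k where
  finish: "greedy_run k [] T T"
| insert: "best_fit k T x s \<Longrightarrow> greedy_run k xs (T(s \<mapsto> x)) T' \<Longrightarrow> greedy_run k (x # xs) T T'"
| discard: "\<forall>s\<in>empty_slots k T. \<not> compatible s x \<Longrightarrow> greedy_run k xs T T' \<Longrightarrow>
            greedy_run k (x # xs) T T'"

definition greedy_output :: "nat \<Rightarrow> real interval set \<Rightarrow> real interval set \<Rightarrow> bool" where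
  "greedy_output k I J \<longleftrightarrow>
     (\<exists>xs T. sorted_wrt sq_less xs \<and> set xs = I \<and> greedy_run k xs Map.empty T \<and> J = ran T)"

end

theory Submission
  imports Defs
begin

text \<open>
  Let \<open>F(t)\<close> be the number of intervals inserted so far plus the number of empty slots of value at
  most \<open>t\<close>. Replay an arbitrary heapable set \<open>J'\<close> in the order of the right endpoints, next to the
  greedy algorithm. Then at every moment greedy has inserted at least as many intervals and its \<open>F\<close>
  is pointwise at least that of the replay. Inserting \<open>[a,b]\<close> into a slot of value \<open>v\<close> increases
  \<open>F(t)\<close> by 1 for \<open>t < v\<close>, by 0 for \<open>v \<le> t < b\<close> and by \<open>k\<close> for \<open>b \<le> t\<close>. If both sides insert
  \<open>[a,b]\<close>, the best-fit choice leaves greedy no slot with value between its own \<open>v\<close> and \<open>a\<close>, which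
  settles the values \<open>t\<close> between the two chosen slots. If only the replay inserts, greedy has no
  slot of value at most \<open>a\<close>, so the inequality at \<open>t = v\<close> shows that greedy is strictly ahead.
  For \<open>t\<close> beyond all right endpoints, \<open>F(t) = 1 + k c\<close> with \<open>c\<close> the number of inserted intervals.
\<close>

section \<open>Sorting by the total order on intervals\<close>

lemma sq_less_trans: "sq_less x y \<Longrightarrow> sq_less y z \<Longrightarrow> sq_less x z"
  by (auto simp: sq_less_def)

lemma sq_less_linear: "sq_less x y \<or> x = y \<or> sq_less y x"
  by (auto simp: sq_less_def interval_eq_iff)

lemma sq_less_imp_upper_le: "sq_less x y \<Longrightarrow> upper x \<le> upper y"
  by (auto simp: sq_less_def)

lemma finite_has_sq_least:
  assumes "finite A" "A \<noteq> {}"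
  shows "\<exists>x\<in>A. \<forall>y\<in>A - {x}. sq_less x y"
  using assms
proof (induction rule: finite_ne_induct)
  case (insert x A)
  then obtain m where m: "m \<in> A" "\<forall>y\<in>A - {m}. sq_less m y" by blast
  show ?case
  proof (cases "sq_less x m")
    case True
    with m have "\<forall>y\<in>A. sq_less x y" by (metis DiffI singletonD sq_less_trans)
    then show ?thesis by blast
  next
    case False
    with m insert.hyps sq_less_linear[of x m] show ?thesis by blast
  qed
qed simp

lemma sq_sorted_list_exists:
  assumes "finite I"
  shows "\<exists>xs. sorted_wrt sq_less xs \<and> set xs = I"
  using assms
proof (induction I rule: finite_psubset_induct)
  case (psubset I)
  show ?case
  proof (cases "I = {}")
    case False
    then obtain x where x: "x \<in> I" "\<forall>y\<in>I - {x}. sq_less x y"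
      using finite_has_sq_least psubset.hyps by blast
    then obtain xs where "sorted_wrt sq_less xs" "set xs = I - {x}"
      using psubset.IH[of "I - {x}"] by blast
    with x have "sorted_wrt sq_less (x # xs) \<and> set (x # xs) = I" by auto
    then show ?thesis by blast
  qed simp
qed

section \<open>States\<close>

text \<open>All positions, filled or empty, of a tree with vertex set \<open>A\<close>. A child
  position is identified by its parent interval, so the set depends on \<open>A\<close> alone and
  not on the shape of the tree.\<close>

definition slots :: "nat \<Rightarrow> real interval set \<Rightarrow> slot set" where
  "slots k A = insert Root ((\<lambda>(x, i). Child x i) ` (A \<times> {..<k}))"

lemma Root_in_slots [simp]: "Root \<in> slots k A"
  and Child_in_slots [simp]: "Child x i \<in> slots k A \<longleftrightarrow> x \<in> A \<and> i < k"
  by (auto simp: slots_def)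

lemma slots_insert: "slots k (insert x A) = slots k A \<union> Child x ` {..<k}"
  by (auto simp: slots_def)

lemma finite_slots [simp]: "finite A \<Longrightarrow> finite (slots k A)"
  by (simp add: slots_def)

lemma card_slots:
  assumes "finite A"
  shows "card (slots k A) = 1 + k * card A"
proof -
  have "inj_on (\<lambda>(x, i). Child x i) (A \<times> {..<k})" by (auto simp: inj_on_def)
  then show ?thesis
    unfolding slots_def using assms by (subst card_insert_disjoint) (auto simp: card_image)
qed

lemma empty_slots_eq: "empty_slots k T = slots k (ran T) - dom T"
  by (auto simp: empty_slots_def slots_def)

lemma compatible_Child [simp]: "compatible (Child u i) x \<longleftrightarrow> below u x"
  by (simp add: compatible_def below_def)

lemma compatible_Root [simp]: "compatible Root x"
  by (simp add: compatible_def)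

text \<open>A valid state encodes a heap-ordered \<open>k\<close>-ary tree. Acyclicity is implicit:
  compatibility together with properness makes right endpoints strictly increase from parent to
  child.\<close>

definition valid :: "nat \<Rightarrow> state \<Rightarrow> bool" where
  "valid k T \<longleftrightarrow> finite (dom T) \<and> inj_on T (dom T) \<and> ran T \<subseteq> proper_intervals \<and>
     (\<forall>s x. T s = Some x \<longrightarrow> s \<in> slots k (ran T) \<and> compatible s x)"

lemma valid_empty [simp]: "valid k Map.empty"
  by (simp add: valid_def)

lemma valid_finite_ran: "valid k T \<Longrightarrow> finite (ran T)"
  by (simp add: valid_def finite_ran)

lemma card_ran:
  assumes "valid k T"
  shows "card (ran T) = card (dom T)"
proof -
  have "bij_betw (\<lambda>s. the (T s)) (dom T) (ran T)"
    using assms by (force simp: bij_betw_def valid_def inj_on_def ran_def dom_def image_def)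
  then show ?thesis by (simp add: bij_betw_same_card)
qed

lemma valid_update:
  assumes "valid k T" "s \<in> empty_slots k T" "compatible s x" "x \<notin> ran T" "x \<in> proper_intervals"
  shows "valid k (T(s \<mapsto> x))"
proof -
  have s: "T s = None" "s \<in> slots k (ran T)" using assms(2) by (auto simp: empty_slots_eq)
  then have r: "ran (T(s \<mapsto> x)) = insert x (ran T)" by simp
  have "inj_on (T(s \<mapsto> x)) (dom (T(s \<mapsto> x)))"
    using assms(1,4) s(1) unfolding valid_def inj_on_def
    by (auto simp: ran_def dom_def split: if_splits)
  then show ?thesis
    using assms s unfolding valid_def r by (auto simp: slots_insert)
qed

section \<open>Heapable sets as ranges of valid states\<close>

text \<open>The arcs are read off the child positions. Right endpoints strictly increase along arcs,
  which yields both the root and reachability from it.\<close>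

lemma valid_imp_heapable:
  assumes v: "valid k T"
  shows "k_heapable k (ran T)"
proof (cases "ran T = {}")
  case True
  then show ?thesis unfolding k_heapable_def kary_tree_def by (intro exI[of _ "{}"] exI[of _ "{}"]) auto
next
  case False
  define E where "E = {(u, v). \<exists>i. T (Child u i) = Some v}"
  have inj: "s = s'" if "T s = Some x" "T s' = Some x" for s s' x
    using v that by (auto simp: valid_def inj_on_def dom_def)
  have proper: "lower x < upper x" if "x \<in> ran T" for x
    using v that by (auto simp: valid_def proper_intervals_def)
  have E: "u \<in> ran T \<and> v \<in> ran T \<and> below u v" if "(u, v) \<in> E" for u v
    using that v by (fastforce simp: E_def valid_def intro: ranI)
  have less: "upper u < upper v" if "(u, v) \<in> E" for u v
    using E[OF that] proper[of v] by (auto simp: below_def)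
  have parent: "T Root = Some x \<or> (\<exists>u. (u, x) \<in> E)" if x: "x \<in> ran T" for x
  proof -
    obtain s where "T s = Some x" using x by (auto simp: ran_def)
    then show ?thesis by (cases s) (auto simp: E_def)
  qed
  have fin: "finite (ran T)" using v by (rule valid_finite_ran)
  \<comment> \<open>A parent of \<open>r\<close> would have a strictly smaller right endpoint, so
    \<open>r\<close> can only sit at \<open>Root\<close>.\<close>
  define r where "r = arg_min_on upper (ran T)"
  have r: "r \<in> ran T" "\<And>x. x \<in> ran T \<Longrightarrow> upper r \<le> upper x"
    using arg_min_if_finite[OF fin False, of upper] by (auto simp: r_def not_less)
  have root: "T Root = Some r"
    using parent[OF r(1)] less E r(2) by fastforce
  \<comment> \<open>Climbing to the parent decreases the number of intervals with smaller right
    endpoint.\<close>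
  have reach: "(r, x) \<in> E\<^sup>*" if "x \<in> ran T" for x
    using that
  proof (induction "card {y \<in> ran T. upper y < upper x}" arbitrary: x rule: less_induct)
    case less
    show ?case
    proof (cases "x = r")
      case False
      with parent[OF less.prems] root obtain u where u: "(u, x) \<in> E" by auto
      have "{y \<in> ran T. upper y < upper u} \<subset> {y \<in> ran T. upper y < upper x}"
        using \<open>\<And>u v. (u, v) \<in> E \<Longrightarrow> upper u < upper v\<close>[OF u] E[OF u] by fastforce
      then have "(r, u) \<in> E\<^sup>*"
        using less.hyps[of u] fin E[OF u] by (simp add: psubset_card_mono)
      then show ?thesis using u by (rule rtrancl_into_rtrancl)
    qed simp
  qed
  have "rooted_tree (ran T) E r"
    unfolding rooted_tree_def
  proof (intro conjI ballI allI)
    show "(u, r) \<notin> E" for u using inj[OF root] by (auto simp: E_def)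
    show "\<exists>!u. (u, x) \<in> E" if "x \<in> ran T - {r}" for x
      using parent[of x] that root inj by (fastforce simp: E_def)
  qed (use r(1) E reach in auto)
  moreover have "finite {v. (u, v) \<in> E} \<and> card {v. (u, v) \<in> E} \<le> k" for u
  proof -
    have "{v. (u, v) \<in> E} \<subseteq> (\<lambda>i. the (T (Child u i))) ` {..<k}"
      using v by (force simp: E_def valid_def image_iff)
    then show ?thesis
      by (metis card_lessThan finite_imageI finite_lessThan finite_subset surj_card_le)
  qed
  ultimately have "kary_tree k (ran T) E" unfolding kary_tree_def by blast
  \<comment> \<open>Chaining \<open>below\<close> through \<open>y\<close> uses
    \<open>lower y < upper y\<close>.\<close>
  moreover have "v \<in> ran T \<and> below u v" if "(u, v) \<in> E\<^sup>+" for u v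
    using that
  proof (induction rule: trancl_induct)
    case (step y z)
    then show ?case using E[of y z] proper[of y] by (auto simp: below_def)
  qed (use E in blast)
  ultimately show ?thesis
    unfolding k_heapable_def
    by (intro exI[of _ "ran T"] exI[of _ E] exI[of _ "\<lambda>x. x"]) (auto simp: bij_betw_def)
qed

text \<open>Heapability supplies a position for each interval; the state is the inverse of this
  injective placement.\<close>

lemma valid_of_slot_assignment:
  assumes "finite J" "J \<subseteq> proper_intervals" "inj_on g J"
    and g: "\<And>x. x \<in> J \<Longrightarrow> g x \<in> slots k J \<and> compatible (g x) x"
  shows "\<exists>T. valid k T \<and> ran T = J"
proof -
  define T where "T s = (if s \<in> g ` J then Some (inv_into J g s) else None)" for s
  have T: "T s = Some x \<longleftrightarrow> x \<in> J \<and> g x = s" for s x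
    unfolding T_def by (auto simp: inv_into_f_f[OF assms(3)] inj_on_eq_iff[OF assms(3)])
  then have ran: "ran T = J" by (auto simp: ran_def)
  have "dom T = g ` J" by (auto simp: T_def dom_def)
  moreover have "inj_on T (dom T)"
  proof (rule inj_onI)
    fix s s' assume "s \<in> dom T" "T s = T s'"
    then obtain x where "T s = Some x" "T s' = Some x" by (metis domD)
    then show "s = s'" by (simp add: T)
  qed
  ultimately have "valid k T" using assms T by (simp add: valid_def ran)
  with ran show ?thesis by blast
qed

text \<open>The children of each vertex \<open>u\<close> are numbered injectively by
  \<open>h u\<close>; parent and number together determine the position of a vertex.\<close>

lemma heapable_imp_valid:
  assumes "k_heapable k J" "finite J" "J \<subseteq> proper_intervals"
  shows "\<exists>T. valid k T \<and> ran T = J"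
proof -
  obtain V :: "real interval set" and E f where
    kary: "kary_tree k V E" and bij: "bij_betw f V J" and
    below: "\<And>u v. (u, v) \<in> E\<^sup>+ \<Longrightarrow> below (f u) (f v)"
    using assms(1) unfolding k_heapable_def by blast
  show ?thesis
  proof (cases "V = {}")
    case True
    then have "J = {}" using bij by (simp add: bij_betw_def)
    then show ?thesis using valid_empty[of k] by (intro exI[of _ Map.empty]) simp
  next
    case False
    then obtain r where tree: "rooted_tree V E r"
      and ch: "\<And>u. u \<in> V \<Longrightarrow> finite {v. (u, v) \<in> E} \<and> card {v. (u, v) \<in> E} \<le> k"
      using kary unfolding kary_tree_def by blast
    have "\<exists>h. inj_on h {v. (u, v) \<in> E} \<and> h ` {v. (u, v) \<in> E} \<subseteq> {..<k}" if "u \<in> V" for u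
      using ch[OF that] by (metis card_le_inj card_lessThan finite_lessThan)
    then obtain h where h: "\<And>u. u \<in> V \<Longrightarrow> inj_on (h u) {v. (u, v) \<in> E}"
        "\<And>u. u \<in> V \<Longrightarrow> h u ` {v. (u, v) \<in> E} \<subseteq> {..<k}"
      by metis
    \<comment> \<open>The parent function; its value at \<open>r\<close> is unspecified, and
      \<open>q\<close> treats \<open>r\<close> separately.\<close>
    define p where "p v = (THE u. (u, v) \<in> E)" for v
    have p: "(p v, v) \<in> E" if "v \<in> V" "v \<noteq> r" for v
      using tree that unfolding rooted_tree_def p_def by (metis (mono_tags, lifting) DiffI singletonD theI')
    have pV: "p v \<in> V" if "v \<in> V" "v \<noteq> r" for v
      using tree p[OF that] by (auto simp: rooted_tree_def)
    define q where "q v = (if v = r then Root else Child (f (p v)) (h (p v) v))" for v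
    have f: "inj_on f V" "f ` V = J" using bij by (auto simp: bij_betw_def)
    have q_slot: "q v \<in> slots k J \<and> compatible (q v) (f v)" if "v \<in> V" for v
    proof (cases "v = r")
      case False
      with that have "h (p v) v < k" using h(2)[OF pV] p by blast
      then show ?thesis using False that pV f below[OF r_into_trancl[OF p]] by (auto simp: q_def)
    qed (simp add: q_def)
    have q_inj: "inj_on q V"
    proof (rule inj_onI)
      fix v w assume vw: "v \<in> V" "w \<in> V" "q v = q w"
      show "v = w"
      proof (cases "v = r \<or> w = r")
        case True
        with vw show ?thesis by (auto simp: q_def split: if_splits)
      next
        case False
        with vw have "f (p v) = f (p w)" "h (p v) v = h (p w) w" by (auto simp: q_def)
        moreover from this have "p v = p w" using f(1) False vw pV by (auto dest: inj_onD)
        ultimately show ?thesis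
          using h(1)[OF pV[of v]] p[of v] p[of w] False vw by (auto dest: inj_onD)
      qed
    qed
    let ?g = "\<lambda>x. q (inv_into V f x)"
    have inv: "inv_into V f x \<in> V" "f (inv_into V f x) = x" if "x \<in> J" for x
      using that f by (auto intro: inv_into_into f_inv_into_f)
    have "inj_on ?g J"
    proof (rule inj_onI)
      fix x y assume xy: "x \<in> J" "y \<in> J" "?g x = ?g y"
      then have "inv_into V f x = inv_into V f y" using q_inj inv(1) by (auto dest: inj_onD)
      with xy show "x = y" using inv(2) by metis
    qed
    moreover have "?g x \<in> slots k J \<and> compatible (?g x) x" if "x \<in> J" for x
      using q_slot[OF inv(1)[OF that]] inv(2)[OF that] by simp
    ultimately show ?thesis by (intro valid_of_slot_assignment[OF assms(2,3)])
  qed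
qed

section \<open>The potential of a state\<close>

definition open_slots :: "nat \<Rightarrow> state \<Rightarrow> ereal \<Rightarrow> slot set" where
  "open_slots k T t = {s \<in> empty_slots k T. slot_value s \<le> t}"

text \<open>This is \<open>F\<close>. The argument is an extended real so that it can be the value
  of \<open>Root\<close>.\<close>

definition potential :: "nat \<Rightarrow> state \<Rightarrow> ereal \<Rightarrow> nat" where
  "potential k T t = card (ran T) + card (open_slots k T t)"

text \<open>The invariant, with \<open>T\<close> the greedy state and \<open>S\<close> the replayed
  one.\<close>

definition dominates :: "nat \<Rightarrow> state \<Rightarrow> state \<Rightarrow> bool" where
  "dominates k T S \<longleftrightarrow> card (ran S) \<le> card (ran T) \<and> (\<forall>t. potential k S t \<le> potential k T t)"

lemma finite_empty_slots: "finite (ran T) \<Longrightarrow> finite (empty_slots k T)"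
  by (simp add: empty_slots_eq)

lemma finite_open_slots: "valid k T \<Longrightarrow> finite (open_slots k T t)"
  by (simp add: open_slots_def finite_empty_slots valid_finite_ran)

lemma card_ran_update:
  assumes "valid k T" "s \<in> empty_slots k T" "x \<notin> ran T"
  shows "card (ran (T(s \<mapsto> x))) = Suc (card (ran T))"
proof -
  have "T s = None" using assms(2) by (auto simp: empty_slots_eq)
  then show ?thesis using assms by (simp add: valid_finite_ran)
qed

text \<open>The new interval counts 1, which cancels the loss of \<open>s\<close> exactly when
  \<open>s\<close> was counted; the \<open>k\<close> new slots all have value
  \<open>upper x\<close>.\<close>

lemma potential_update:
  assumes v: "valid k T" and s: "s \<in> empty_slots k T" and x: "x \<notin> ran T"
  shows "potential k (T(s \<mapsto> x)) t = potential k T t + (if slot_value s \<le> t then 0 else 1) +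
           (if ereal (upper x) \<le> t then k else 0)"
proof -
  have sN: "T s = None" and s_slot: "s \<in> slots k (ran T)" using s by (auto simp: empty_slots_eq)
  \<comment> \<open>As \<open>x\<close> is not yet in the tree, its child positions are neither
    filled nor available, so all \<open>k\<close> of them are new.\<close>
  have not_dom: "T (Child x i) = None" "s \<noteq> Child x i" for i
  proof -
    show "T (Child x i) = None"
      using v x by (metis Child_in_slots option.exhaust valid_def)
    show "s \<noteq> Child x i" using s_slot x by auto
  qed
  define N where "N = (if ereal (upper x) \<le> t then Child x ` {..<k} else {})"
  have "empty_slots k (T(s \<mapsto> x)) = empty_slots k T - {s} \<union> Child x ` {..<k}"
    using sN not_dom by (auto simp: empty_slots_eq slots_insert)
  then have "open_slots k (T(s \<mapsto> x)) t = (open_slots k T t - {s}) \<union> N"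
    by (auto simp: open_slots_def N_def)
  moreover have "(open_slots k T t - {s}) \<inter> N = {}"
    using x by (auto simp: N_def open_slots_def empty_slots_eq)
  moreover have "finite N" by (simp add: N_def)
  ultimately have "card (open_slots k (T(s \<mapsto> x)) t) = card (open_slots k T t - {s}) + card N"
    using finite_open_slots[OF v, of t] by (simp add: card_Un_disjoint)
  moreover have "card N = (if ereal (upper x) \<le> t then k else 0)"
    by (simp add: N_def card_image inj_on_def)
  moreover have "s \<in> open_slots k T t \<longleftrightarrow> slot_value s \<le> t"
    using s by (simp add: open_slots_def)
  then have "Suc (card (open_slots k T t - {s})) =
      card (open_slots k T t) + (if slot_value s \<le> t then 0 else 1)"
    using card_Suc_Diff1[OF finite_open_slots[OF v], of s t]
    by (cases "slot_value s \<le> t") (simp_all del: card_Diff_singleton card_Diff_insert)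
  ultimately show ?thesis
    unfolding potential_def using card_ran_update[OF v s x] by simp
qed

text \<open>With \<open>c\<close> intervals there are \<open>1 + k * c\<close> positions,
  \<open>c\<close> of them filled; adding the interval count restores the total.\<close>

lemma potential_full:
  assumes v: "valid k T" and "\<And>x. x \<in> ran T \<Longrightarrow> ereal (upper x) \<le> t"
  shows "potential k T t = 1 + k * card (ran T)"
proof -
  have sub: "dom T \<subseteq> slots k (ran T)" using v by (auto simp: valid_def)
  have "slot_value s \<le> t" if "s \<in> slots k (ran T)" for s
    using that assms(2) by (cases s) auto
  then have "open_slots k T t = slots k (ran T) - dom T"
    by (auto simp: open_slots_def empty_slots_eq)
  then have "card (open_slots k T t) = 1 + k * card (ran T) - card (dom T)"
    using sub v by (simp add: card_Diff_subset valid_def card_slots finite_ran)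
  moreover have "card (dom T) \<le> 1 + k * card (ran T)"
    using card_mono[OF _ sub] v by (simp add: card_slots valid_finite_ran)
  ultimately show ?thesis using card_ran[OF v] by (simp add: potential_def)
qed

text \<open>The slot \<open>s\<close> is counted at its own value but not at
  \<open>t\<close>.\<close>

lemma potential_less:
  assumes "valid k S" "s \<in> empty_slots k S" "t < slot_value s"
  shows "potential k S t < potential k S (slot_value s)"
proof -
  have "s \<in> open_slots k S (slot_value s)" "s \<notin> open_slots k S t"
    "open_slots k S t \<subseteq> open_slots k S (slot_value s)"
    using assms(2,3) by (auto simp: open_slots_def)
  then have "card (open_slots k S t) < card (open_slots k S (slot_value s))"
    by (intro psubset_card_mono finite_open_slots[OF assms(1)]) auto
  then show ?thesis by (simp add: potential_def)
qed

section \<open>One step of greedy against a competitor\<close>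

text \<open>An insertion never lowers the potential.\<close>

lemma dominates_greedy_only:
  assumes "dominates k T S" "valid k T" "s \<in> empty_slots k T" "x \<notin> ran T"
  shows "dominates k (T(s \<mapsto> x)) S"
proof -
  have "potential k S t \<le> potential k T t" for t
    using assms(1) by (simp add: dominates_def)
  then have "potential k S t \<le> potential k (T(s \<mapsto> x)) t" for t
    unfolding potential_update[OF assms(2-4)] by (intro trans_le_add1)
  then show ?thesis
    using assms(1) card_ran_update[OF assms(2-4)] by (simp add: dominates_def)
qed

text \<open>The replay gains more than greedy only for \<open>t\<close> from
  \<open>slot_value s\<close> up to but excluding \<open>slot_value s'\<close>, so one unit of slack
  is needed there.\<close>

lemma dominates_both:
  assumes dom: "dominates k T S" and T: "valid k T" "best_fit k T x s" "x \<notin> ran T"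
    and S: "valid k S" "s' \<in> empty_slots k S" "compatible s' x" "x \<notin> ran S"
  shows "dominates k (T(s \<mapsto> x)) (S(s' \<mapsto> x))"
proof -
  have s: "s \<in> empty_slots k T" using T(2) by (simp add: best_fit_def)
  have le: "potential k S t \<le> potential k T t" for t using dom by (simp add: dominates_def)
  \<comment> \<open>From \<open>t\<close> to \<open>slot_value s'\<close> the potential of
    \<open>T\<close> stays constant by best fit, whereas that of \<open>S\<close> rises strictly
    because of \<open>s'\<close>.\<close>
  have "potential k S t + 1 \<le> potential k T t"
    if t: "slot_value s \<le> t" "t < slot_value s'" for t
  proof -
    have "open_slots k T (slot_value s') \<subseteq> open_slots k T t"
    proof
      fix u assume "u \<in> open_slots k T (slot_value s')"
      then have u: "u \<in> empty_slots k T" "slot_value u \<le> slot_value s'" by (auto simp: open_slots_def)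
      then have "compatible u x" using S(3) by (auto simp: compatible_def)
      then have "slot_value u \<le> slot_value s" using T(2) u by (simp add: best_fit_def)
      with t u show "u \<in> open_slots k T t" by (auto simp: open_slots_def)
    qed
    then have "potential k T (slot_value s') \<le> potential k T t"
      by (simp add: potential_def card_mono finite_open_slots[OF T(1)])
    with potential_less[OF S(1,2) t(2)] le[of "slot_value s'"] show ?thesis by simp
  qed
  then have "potential k (S(s' \<mapsto> x)) t \<le> potential k (T(s \<mapsto> x)) t" for t
    using le[of t] by (auto simp: potential_update[OF T(1) s T(3)] potential_update[OF S(1,2,4)] not_le)
  then show ?thesis
    using dom card_ran_update[OF T(1) s T(3)] card_ran_update[OF S(1,2,4)]
    by (simp add: dominates_def)
qed

text \<open>Three ranges of \<open>t\<close> are separated by \<open>slot_value s'\<close> and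
  \<open>upper x\<close>. The bound on right endpoints, due to the processing order, makes both
  potentials full in the top range.\<close>

lemma dominates_competitor_only:
  assumes dom: "dominates k T S" and T: "valid k T" "\<forall>s\<in>empty_slots k T. \<not> compatible s x"
    and S: "valid k S" "s' \<in> empty_slots k S" "compatible s' x" "x \<notin> ran S" "x \<in> proper_intervals"
    and upper: "\<And>y. y \<in> ran T \<union> ran S \<Longrightarrow> upper y \<le> upper x"
  shows "dominates k T (S(s' \<mapsto> x))"
proof -
  let ?S = "S(s' \<mapsto> x)"
  have le: "potential k S t \<le> potential k T t" for t using dom by (simp add: dominates_def)
  \<comment> \<open>Any such slot would be compatible with \<open>x\<close>, because
    \<open>s'\<close> is.\<close>
  have "open_slots k T (slot_value s') = {}"
    using T(2) S(3) by (auto simp: open_slots_def compatible_def intro: order_trans)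
  then have no: "potential k T (slot_value s') = card (ran T)" by (simp add: potential_def)
  have "s' \<in> open_slots k S (slot_value s')" using S(2) by (simp add: open_slots_def)
  then have "0 < card (open_slots k S (slot_value s'))"
    using finite_open_slots[OF S(1)] by (auto simp: card_gt_0_iff)
  with no le[of "slot_value s'"] have ahead: "card (ran S) < card (ran T)"
    by (simp add: potential_def)
  have ran: "ran ?S = insert x (ran S)" using S(2) by (auto simp: empty_slots_eq domIff)
  have "potential k ?S t \<le> potential k T t" for t
  proof (cases "ereal (upper x) \<le> t")
    case True
    have "potential k ?S t = 1 + k * card (ran ?S)"
    proof (rule potential_full[OF valid_update[OF S]])
      fix y assume "y \<in> ran ?S"
      then have "upper y \<le> upper x" using upper unfolding ran by auto
      with True show "ereal (upper y) \<le> t" by (meson ereal_less_eq(3) order_trans)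
    qed
    moreover have "potential k T t = 1 + k * card (ran T)"
    proof (rule potential_full[OF T(1)])
      fix y assume "y \<in> ran T"
      then have "upper y \<le> upper x" using upper by auto
      with True show "ereal (upper y) \<le> t" by (meson ereal_less_eq(3) order_trans)
    qed
    moreover have "card (ran ?S) \<le> card (ran T)"
      using ahead card_ran_update[OF S(1,2,4)] by simp
    ultimately show ?thesis by simp
  next
    case False
    show ?thesis
    proof (cases "slot_value s' \<le> t")
      case True
      with False le[of t] show ?thesis by (simp add: potential_update[OF S(1,2,4)])
    next
      case less: False
      \<comment> \<open>Below \<open>slot_value s'\<close> the replay gains 1, which this strict
        inequality absorbs.\<close>
      then have "potential k S t < card (ran T)"
        using potential_less[OF S(1,2), of t] le[of "slot_value s'"] no by (simp add: not_le)
      with False less show ?thesis by (simp add: potential_update[OF S(1,2,4)] potential_def[of k T])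
    qed
  qed
  then show ?thesis using ahead card_ran_update[OF S(1,2,4)] by (simp add: dominates_def)
qed

section \<open>Replaying a valid state\<close>

text \<open>The replay of \<open>S\<close> after the intervals in \<open>P\<close> have been
  processed; each interval keeps its position from \<open>S\<close>.\<close>

definition part :: "state \<Rightarrow> real interval set \<Rightarrow> state" where
  "part S P = S |` {s. \<exists>x\<in>P. S s = Some x}"

lemma part_Some [simp]: "part S P s = Some x \<longleftrightarrow> S s = Some x \<and> x \<in> P"
  by (auto simp: part_def restrict_map_def)

lemma ran_part: "ran (part S P) = ran S \<inter> P"
  by (auto simp: ran_def)

text \<open>By injectivity of \<open>S\<close>, \<open>s\<close> is the only position that holds
  \<open>x\<close>.\<close>

lemma part_insert:
  assumes "valid k S" "S s = Some x"
  shows "part S (insert x P) = (part S P)(s \<mapsto> x)"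
proof
  fix s'
  show "part S (insert x P) s' = ((part S P)(s \<mapsto> x)) s'"
    using assms by (auto simp: part_def restrict_map_def valid_def inj_on_def dom_def)
qed

lemma part_insert_outside: "x \<notin> ran S \<Longrightarrow> part S (insert x P) = part S P"
  by (auto simp: part_def restrict_map_def fun_eq_iff ran_def)

text \<open>The parent of \<open>x\<close> has a strictly smaller right endpoint, hence has already
  been replayed and offers the position \<open>s\<close>.\<close>

lemma part_next_slot:
  assumes v: "valid k S" and x: "S s = Some x" "x \<notin> P"
    and closed: "\<And>u. u \<in> ran S \<Longrightarrow> upper u < upper x \<Longrightarrow> u \<in> P"
  shows "s \<in> empty_slots k (part S P)" "compatible s x"
proof -
  show c: "compatible s x" using v x by (auto simp: valid_def)
  have "part S P s = None" using x by (auto simp: part_def restrict_map_def)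
  moreover have "s \<in> slots k (ran S \<inter> P)"
  proof (cases s)
    case (Child u i)
    have "u \<in> ran S" "i < k" using v x Child by (fastforce simp: valid_def)+
    moreover have "lower x < upper x"
      using v x(1) by (auto simp: valid_def proper_intervals_def ran_def)
    then have "upper u < upper x"
      using c Child by (simp add: below_def)
    ultimately show ?thesis using Child closed by simp
  qed simp
  ultimately show "s \<in> empty_slots k (part S P)"
    by (simp add: empty_slots_eq ran_part domIff)
qed

text \<open>A case rule for one replay step, skip or insert, shared by the inserting and discarding
  cases of greedy.\<close>

lemma part_step:
  assumes "valid k S" "valid k (part S P)" "x \<in> proper_intervals" "ran S \<subseteq> P \<union> set (x # xs)"
    and "sorted_wrt sq_less (x # xs)" "x \<notin> P"
  obtains "x \<notin> ran S" "part S (insert x P) = part S P"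
  | s where "s \<in> empty_slots k (part S P)" "compatible s x" "x \<notin> ran (part S P)"
      "part S (insert x P) = (part S P)(s \<mapsto> x)" "valid k (part S (insert x P))"
proof (cases "x \<in> ran S")
  case False
  then show ?thesis using that(1) part_insert_outside by blast
next
  case True
  then obtain s where s: "S s = Some x" by (auto simp: ran_def)
  have "u \<in> P" if "u \<in> ran S" "upper u < upper x" for u
    using that assms(4,5) sq_less_imp_upper_le by fastforce
  then have slot: "s \<in> empty_slots k (part S P)" "compatible s x"
    using part_next_slot[OF assms(1) s assms(6)] by blast+
  have x: "x \<notin> ran (part S P)" using assms(6) by (simp add: ran_part)
  have "valid k ((part S P)(s \<mapsto> x))" by (rule valid_update[OF assms(2) slot x assms(3)])
  with that(2)[OF slot x] part_insert[OF assms(1) s] show ?thesis by simp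
qed

text \<open>Induction over the run, where \<open>P\<close> collects the intervals processed so far,
  including the discarded ones.\<close>

lemma greedy_run_dominates:
  assumes "greedy_run k xs T T'" "sorted_wrt sq_less xs" "set xs \<subseteq> proper_intervals"
    and "valid k S" "valid k T" "valid k (part S P)" "dominates k T (part S P)"
    and "ran S \<subseteq> P \<union> set xs" "ran T \<subseteq> P"
    and "\<And>y x. y \<in> P \<Longrightarrow> x \<in> set xs \<Longrightarrow> sq_less y x"
  shows "card (ran S) \<le> card (ran T')"
  using assms
proof (induction arbitrary: P rule: greedy_run.induct)
  case (finish T)
  then have "ran S \<inter> P = ran S" by auto
  with finish show ?case by (simp add: dominates_def ran_part)
next
  case (insert T x s xs T')
  \<comment> \<open>Otherwise \<open>sq_less x x\<close> would hold.\<close>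
  have xP: "x \<notin> P" using insert.prems(9)[of x x] by (auto simp: sq_less_def)
  then have xT: "x \<notin> ran T" using insert.prems(8) by blast
  have x: "x \<in> proper_intervals" using insert.prems(2) by simp
  have s: "s \<in> empty_slots k T" "compatible s x"
    using insert.hyps(1) by (auto simp: best_fit_def)
  have "valid k (part S (insert x P)) \<and> dominates k (T(s \<mapsto> x)) (part S (insert x P))"
  proof (rule part_step[OF insert.prems(3,5) x insert.prems(7,1) xP])
    assume "part S (insert x P) = part S P"
    with insert.prems(5) dominates_greedy_only[OF insert.prems(6,4) s(1) xT] show ?thesis by simp
  next
    fix s' assume "s' \<in> empty_slots k (part S P)" "compatible s' x" "x \<notin> ran (part S P)"
      "part S (insert x P) = (part S P)(s' \<mapsto> x)" "valid k (part S (insert x P))"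
    with dominates_both[OF insert.prems(6,4) insert.hyps(1) xT insert.prems(5), of s'] show ?thesis
      by simp
  qed
  moreover have "ran (T(s \<mapsto> x)) \<subseteq> insert x P"
    using insert.prems(8) s(1) by (auto simp: empty_slots_eq domIff)
  moreover have "sq_less y z" if "y \<in> insert x P" "z \<in> set xs" for y z
    using that insert.prems(1,9) by auto
  ultimately show ?case
    using insert.prems valid_update[OF insert.prems(4) s xT x]
    by (intro insert.IH[of "insert x P"]) (auto simp del: fun_upd_apply)
next
  case (discard T x xs T')
  have xP: "x \<notin> P" using discard.prems(9)[of x x] by (auto simp: sq_less_def)
  have x: "x \<in> proper_intervals" using discard.prems(2) by simp
  have "valid k (part S (insert x P)) \<and> dominates k T (part S (insert x P))"
  proof (rule part_step[OF discard.prems(3,5) x discard.prems(7,1) xP])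
    assume "part S (insert x P) = part S P"
    with discard.prems(5,6) show ?thesis by simp
  next
    fix s' assume s': "s' \<in> empty_slots k (part S P)" "compatible s' x" "x \<notin> ran (part S P)"
      and S': "part S (insert x P) = (part S P)(s' \<mapsto> x)" "valid k (part S (insert x P))"
    \<comment> \<open>Both trees contain only processed intervals, and these precede
      \<open>x\<close>.\<close>
    have "upper y \<le> upper x" if "y \<in> ran T \<union> ran (part S P)" for y
      using that discard.prems(8,9) by (auto simp: ran_part intro!: sq_less_imp_upper_le)
    with dominates_competitor_only[OF discard.prems(6,4) discard.hyps(1) discard.prems(5) s' x] S'
    show ?thesis by simp
  qed
  moreover have "sq_less y z" if "y \<in> insert x P" "z \<in> set xs" for y z
    using that discard.prems(1,9) by auto
  ultimately show ?case
    using discard.prems by (intro discard.IH[of "insert x P"]) auto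
qed

section \<open>Validity and existence of greedy runs\<close>

lemma greedy_run_valid:
  assumes "greedy_run k xs T T'" "valid k T" "distinct xs" "set xs \<inter> ran T = {}"
    and "set xs \<subseteq> proper_intervals"
  shows "valid k T' \<and> ran T' \<subseteq> ran T \<union> set xs"
  using assms
proof (induction rule: greedy_run.induct)
  case (insert T x s xs T')
  have s: "s \<in> empty_slots k T" "compatible s x"
    using insert.hyps(1) by (auto simp: best_fit_def)
  then have ran: "ran (T(s \<mapsto> x)) = insert x (ran T)" by (simp add: empty_slots_eq domIff)
  have "valid k (T(s \<mapsto> x))"
    using insert.prems by (intro valid_update[OF insert.prems(1) s]) auto
  then have "valid k T' \<and> ran T' \<subseteq> ran (T(s \<mapsto> x)) \<union> set xs"
    using insert.prems by (intro insert.IH) (auto simp: ran simp del: fun_upd_apply)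
  then show ?case unfolding ran by auto
qed auto

text \<open>Finitely many empty slots guarantee a best fit whenever some slot is compatible, so a
  run never gets stuck.\<close>

lemma greedy_run_exists:
  assumes "finite (ran T)"
  shows "\<exists>T'. greedy_run k xs T T'"
  using assms
proof (induction xs arbitrary: T)
  case Nil
  show ?case using greedy_run.finish by blast
next
  case (Cons x xs)
  let ?C = "{s \<in> empty_slots k T. compatible s x}"
  show ?case
  proof (cases "?C = {}")
    case True
    then show ?thesis using Cons greedy_run.discard by blast
  next
    case False
    have fin: "finite ?C" using finite_empty_slots Cons.prems by simp
    have "Max (slot_value ` ?C) \<in> slot_value ` ?C" using fin False by (intro Max_in) auto
    then obtain s where s: "s \<in> ?C" "slot_value s = Max (slot_value ` ?C)" by auto
    then have "\<forall>s'\<in>?C. slot_value s' \<le> slot_value s" using fin by simp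
    with s(1) have best: "best_fit k T x s" by (simp add: best_fit_def)
    then have "finite (ran (T(s \<mapsto> x)))"
      using Cons.prems by (simp add: best_fit_def empty_slots_eq domIff)
    with Cons.IH best show ?thesis using greedy_run.insert by blast
  qed
qed

lemma sorted_wrt_sq_less_distinct: "sorted_wrt sq_less xs \<Longrightarrow> distinct xs"
  by (induction xs) (auto simp: sq_less_def)

theorem theorem5:
  fixes k :: nat and I :: "real interval set"
  assumes "k \<ge> 1" and "finite I" and "I \<subseteq> proper_intervals"
  shows "(\<exists>J. greedy_output k I J) \<and>
         (\<forall>J. greedy_output k I J \<longrightarrow>
            J \<subseteq> I \<and> k_heapable k J \<and>
            (\<forall>J'. J' \<subseteq> I \<and> k_heapable k J' \<longrightarrow> card J' \<le> card J))"
proof (intro conjI allI impI)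
  show "\<exists>J. greedy_output k I J"
    using sq_sorted_list_exists[OF assms(2)] greedy_run_exists[of Map.empty k]
    unfolding greedy_output_def by (metis finite.emptyI ran_empty)
next
  fix J assume "greedy_output k I J"
  then obtain xs T where run: "sorted_wrt sq_less xs" "set xs = I"
      "greedy_run k xs Map.empty T" "J = ran T"
    unfolding greedy_output_def by blast
  have T: "valid k T \<and> ran T \<subseteq> I"
    using greedy_run_valid[OF run(3)] sorted_wrt_sq_less_distinct[OF run(1)] run(2) assms(3) by simp
  then show "J \<subseteq> I" "k_heapable k J" using valid_imp_heapable run(4) by auto
  fix J' assume J': "J' \<subseteq> I \<and> k_heapable k J'"
  then obtain S where S: "valid k S" "ran S = J'"
    using heapable_imp_valid assms(2,3) by (metis finite_subset subset_trans)
  \<comment> \<open>The replay starts from the same empty state as greedy, so domination holds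
    initially by reflexivity.\<close>
  have "part S {} = Map.empty" by (simp add: part_def)
  with greedy_run_dominates[OF run(3,1) _ S(1), of "{}"] S(2) J' run(2,4) assms(3)
  show "card J' \<le> card J" by (simp add: dominates_def)
qed

end
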